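(* Let $A$ be a perm algebra, $E$ a vector space that contains $A$ as a subspace and $V=\mathbb{K}\{x\}$ a one-dimensional complement of $A$ in $E$. Then the relation $\approx$ is an equivalence relation on the set $\mathcal{FL}(A)$ of flag datums of $A$, and there is a bijection between $\mathrm{Ext}(E,A)$ and $\mathcal{FL}(A)/\approx$.
   Context: All vector spaces are over a field $\mathbb{K}$ of characteristic zero. A perm algebra is a vector space $A$ with a bilinear product satisfying $(a_1a_2)a_3=a_1(a_2a_3)=a_1(a_3a_2)$ for all $a_1,a_2,a_3\in A$ (no unit is required). $\mathrm{Ext}(E,A)$ is the set of equivalence classes of perm algebra structures on $E$ containing $A$ as a subalgebra, where $(E,\diamond)$ and $(E,\diamond')$ are equivalent if there is a perm algebra isomorphism $(E,\diamond)\to(E,\diamond')$ that restricts to the identity on $A$. A flag datum of $A$ is a 6-tuple $(h,g,D,T,\tilde a,\tilde k)$ with $\tilde a\in A$, $\tilde k\in\mathbb{K}$ and linear maps $g,h:A\to\mathbb{K}$, $D,T:A\to A$ such that for all $a,a_1,a_2\in A$: $h(a_1a_2)=h(a_1)h(a_2)=h(a_1)g(a_2)$ and $h(T(a))=0$; $g(a_1a_2)=g(a_2a_1)=g(a_1)g(a_2)$; $D(a_1a_2)=D(a_2a_1)=D(a_1)a_2+g(a_1)D(a_2)$; $T(a_1a_2)=a_1T(a_2)+T(a_1)h(a_2)=a_1D(a_2)+T(a_1)g(a_2)=T(a_1)a_2+h(a_1)D(a_2)$; $\tilde kg(a)=\tilde kg(a)+g(D(a))=\tilde kh(a)+g(T(a))=\tilde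 kg(a)+h(D(a))$; $a\tilde a+\tilde kT(a)=T(T(a))+h(a)\tilde a$; $\tilde aa+\tilde kD(a)=D(D(a))+g(a)\tilde a=D(T(a))+h(a)\tilde a=T(D(a))+g(a)\tilde a$; $g(\tilde a)=h(\tilde a)$ and $T(\tilde a)=D(\tilde a)$. $\mathcal{FL}(A)$ is the set of all flag datums of $A$. Flag datums $(h,g,D,T,\tilde a,\tilde k)$ and $(h',g',D',T',\tilde a',\tilde k')$ are equivalent ($\approx$) if $h=h'$, $g=g'$ and there exist $\vec a\in A$ and a nonzero $l\in\mathbb{K}$ such that for all $a\in A$: $D(a)=\vec aa+lD'(a)-g(a)\vec a$; $T(a)=a\vec a+lT'(a)-h(a)\vec a$; $\tilde a=\vec a^{2}+lD'(\vec a)+lT'(\vec a)+l^{2}\tilde a'-\tilde k\vec a$; $\tilde k=l\tilde k'+h'(\vec a)+g'(\vec a)$. *)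

theory Defs
  imports Complex_Main "HOL-Library.FuncSet"
begin

definition linear_on ::
  "'b::ab_group_add set \<Rightarrow> ('k::field \<Rightarrow> 'b \<Rightarrow> 'b) \<Rightarrow> ('k \<Rightarrow> 'c::ab_group_add \<Rightarrow> 'c) \<Rightarrow> ('b \<Rightarrow> 'c) \<Rightarrow> bool"
where
  "linear_on A s1 s2 f \<longleftrightarrow>
    (\<forall>a\<in>A. \<forall>b\<in>A. f (a + b) = f a + f b) \<and> (\<forall>c. \<forall>a\<in>A. f (s1 c a) = s2 c (f a))"

text \<open>
  A perm algebra whose underlying space is a subspace \<open>A\<close> of the vector space given by the
  scalar multiplication \<open>s\<close>. The values of \<open>m\<close> outside \<open>A\<close> are irrelevant.
\<close>

definition perm_algebra_on ::
  "('k::field \<Rightarrow> 'e::ab_group_add \<Rightarrow> 'e) \<Rightarrow> 'e set \<Rightarrow> ('e \<Rightarrow> 'e \<Rightarrow> 'e) \<Rightarrow> bool"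
where
  "perm_algebra_on s A m \<longleftrightarrow>
    module.subspace s A \<and>
    (\<forall>a\<in>A. \<forall>b\<in>A. m a b \<in> A) \<and>
    (\<forall>a\<in>A. linear_on A s s (\<lambda>b. m a b)) \<and>
    (\<forall>b\<in>A. linear_on A s s (\<lambda>a. m a b)) \<and>
    (\<forall>a\<in>A. \<forall>b\<in>A. \<forall>c\<in>A. m (m a b) c = m a (m b c) \<and> m a (m b c) = m a (m c b))"

text \<open>In what follows the space \<open>E\<close> is the whole type \<open>'e\<close>.\<close>

definition perm_iso ::
  "('k::field \<Rightarrow> 'e::ab_group_add \<Rightarrow> 'e) \<Rightarrow> ('e \<Rightarrow> 'e \<Rightarrow> 'e) \<Rightarrow> ('e \<Rightarrow> 'e \<Rightarrow> 'e) \<Rightarrow> ('e \<Rightarrow> 'e) \<Rightarrow> bool"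
where
  "perm_iso s d d' \<phi> \<longleftrightarrow>
    Vector_Spaces.linear s s \<phi> \<and> bij \<phi> \<and> (\<forall>u v. \<phi> (d u v) = d' (\<phi> u) (\<phi> v))"

definition ext_structures ::
  "('k::field \<Rightarrow> 'e::ab_group_add \<Rightarrow> 'e) \<Rightarrow> 'e set \<Rightarrow> ('e \<Rightarrow> 'e \<Rightarrow> 'e) \<Rightarrow> ('e \<Rightarrow> 'e \<Rightarrow> 'e) set"
where
  "ext_structures s A m =
    {d. perm_algebra_on s UNIV d \<and> (\<forall>a\<in>A. \<forall>b\<in>A. d a b = m a b)}"

definition ext_equiv ::
  "('k::field \<Rightarrow> 'e::ab_group_add \<Rightarrow> 'e) \<Rightarrow> 'e set \<Rightarrow> ('e \<Rightarrow> 'e \<Rightarrow> 'e) \<Rightarrow>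
   (('e \<Rightarrow> 'e \<Rightarrow> 'e) \<times> ('e \<Rightarrow> 'e \<Rightarrow> 'e)) set"
where
  "ext_equiv s A m =
    {(d, d'). d \<in> ext_structures s A m \<and> d' \<in> ext_structures s A m \<and>
       (\<exists>\<phi>. perm_iso s d d' \<phi> \<and> (\<forall>a\<in>A. \<phi> a = a))}"

definition Ext ::
  "('k::field \<Rightarrow> 'e::ab_group_add \<Rightarrow> 'e) \<Rightarrow> 'e set \<Rightarrow> ('e \<Rightarrow> 'e \<Rightarrow> 'e) \<Rightarrow> ('e \<Rightarrow> 'e \<Rightarrow> 'e) set set"
where
  "Ext s A m = ext_structures s A m // ext_equiv s A m"

type_synonym ('k, 'e) flag = "('e \<Rightarrow> 'k) \<times> ('e \<Rightarrow> 'k) \<times> ('e \<Rightarrow> 'e) \<times> ('e \<Rightarrow> 'e) \<times> 'e \<times> 'k"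

text \<open>
  Maps defined on \<open>A\<close> are represented by extensional functions, so that two of them are equal
  in HOL if and only if they agree on \<open>A\<close>. The elements \<open>a0\<close>, \<open>k0\<close> are the components
  \<open>\<tilde>a\<close>, \<open>\<tilde>k\<close> of a flag datum. The equations say that the product on \<open>A \<oplus> V\<close> extending that
  of \<open>A\<close> by \<open>x a = D a + g a x\<close>, \<open>a x = T a + h a x\<close> and \<open>x x = a0 + k0 x\<close> is a perm algebra.
\<close>

definition flag_datum ::
  "('k::field \<Rightarrow> 'e::ab_group_add \<Rightarrow> 'e) \<Rightarrow> 'e set \<Rightarrow> ('e \<Rightarrow> 'e \<Rightarrow> 'e) \<Rightarrow> ('k, 'e) flag \<Rightarrow> bool"
where
  "flag_datum s A m = (\<lambda>(h, g, D, T, a0, k0).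
    a0 \<in> A \<and>
    h \<in> A \<rightarrow>\<^sub>E UNIV \<and> linear_on A s (*) h \<and>
    g \<in> A \<rightarrow>\<^sub>E UNIV \<and> linear_on A s (*) g \<and>
    D \<in> A \<rightarrow>\<^sub>E A \<and> linear_on A s s D \<and>
    T \<in> A \<rightarrow>\<^sub>E A \<and> linear_on A s s T \<and>
    (\<forall>a1\<in>A. \<forall>a2\<in>A.
      h (m a1 a2) = h a1 * h a2 \<and> h a1 * h a2 = h a1 * g a2 \<and>
      g (m a1 a2) = g (m a2 a1) \<and> g (m a2 a1) = g a1 * g a2 \<and>
      D (m a1 a2) = D (m a2 a1) \<and> D (m a2 a1) = m (D a1) a2 + s (g a1) (D a2) \<and>
      T (m a1 a2) = m a1 (T a2) + s (h a2) (T a1) \<and>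
      m a1 (T a2) + s (h a2) (T a1) = m a1 (D a2) + s (g a2) (T a1) \<and>
      m a1 (D a2) + s (g a2) (T a1) = m (T a1) a2 + s (h a1) (D a2)) \<and>
    (\<forall>a\<in>A.
      h (T a) = 0 \<and>
      k0 * g a = k0 * g a + g (D a) \<and>
      k0 * g a + g (D a) = k0 * h a + g (T a) \<and>
      k0 * h a + g (T a) = k0 * g a + h (D a) \<and>
      m a a0 + s k0 (T a) = T (T a) + s (h a) a0 \<and>
      m a0 a + s k0 (D a) = D (D a) + s (g a) a0 \<and>
      D (D a) + s (g a) a0 = D (T a) + s (h a) a0 \<and>
      D (T a) + s (h a) a0 = T (D a) + s (g a) a0) \<and>
    g a0 = h a0 \<and> T a0 = D a0)"

definition FL ::
  "('k::field \<Rightarrow> 'e::ab_group_add \<Rightarrow> 'e) \<Rightarrow> 'e set \<Rightarrow> ('e \<Rightarrow> 'e \<Rightarrow> 'e) \<Rightarrow> ('k, 'e) flag set"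
where
  "FL s A m = {F. flag_datum s A m F}"

definition flag_equiv ::
  "('k::field \<Rightarrow> 'e::ab_group_add \<Rightarrow> 'e) \<Rightarrow> 'e set \<Rightarrow> ('e \<Rightarrow> 'e \<Rightarrow> 'e) \<Rightarrow>
   (('k, 'e) flag \<times> ('k, 'e) flag) set"
where
  "flag_equiv s A m =
    {((h, g, D, T, a0, k0), (h', g', D', T', a0', k0')) | h g D T a0 k0 h' g' D' T' a0' k0'.
      (h, g, D, T, a0, k0) \<in> FL s A m \<and> (h', g', D', T', a0', k0') \<in> FL s A m \<and>
      h = h' \<and> g = g' \<and>
      (\<exists>b\<in>A. \<exists>l. l \<noteq> 0 \<and>
        (\<forall>a\<in>A. D a = m b a + s l (D' a) - s (g a) b \<and>
               T a = m a b + s l (T' a) - s (h a) b) \<and>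
        a0 = m b b + s l (D' b) + s l (T' b) + s (l^2) a0' - s k0 b \<and>
        k0 = l * k0' + h' b + g' b)}"

end

theory Submission imports Defs begin

text \<open>
  Write \<open>E = A \<oplus> K x\<close>. A bilinear product on \<open>E\<close> that extends the one of \<open>A\<close> is the same thing as
  the values \<open>a x = T a + h a x\<close>, \<open>x a = D a + g a x\<close> and \<open>x x = a0 + k0 x\<close>, that is, as a tuple
  \<open>(h, g, D, T, a0, k0)\<close>. The perm identities are trilinear, so it is enough to test them on
  triples from \<open>A \<union> {x}\<close>; comparing the components in \<open>A\<close> and along \<open>x\<close> of these
  identities gives precisely the equations of a flag datum (\<open>flag_datum_flag_of_iff\<close>). Hence
  \<open>flag_of\<close> is a bijection from the perm structures on \<open>E\<close> extending \<open>A\<close> to the flag data, with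
  inverse \<open>flag_prod\<close>.

  An isomorphism that is the identity on \<open>A\<close> is determined by \<open>x \<mapsto> b + l x\<close> with \<open>b \<in> A\<close>,
  and it is bijective if and only if \<open>l \<noteq> 0\<close>. Multiplicativity need only be tested on \<open>A \<union> {x}\<close>,
  where it becomes the system of equations relating equivalent flag data
  (\<open>ext_equiv_iff_flag_equiv\<close>). So \<open>flag_of\<close> carries the relation of equivalent structures to
  \<open>\<approx>\<close>; the former is clearly an equivalence relation, and both claims follow by transport.
\<close>

section \<open>Transport of an equivalence relation along a bijection\<close>

lemma equiv_transport:
  assumes "equiv X R" and bij: "bij_betw f X Y" and "S \<subseteq> Y \<times> Y"
    and iff: "\<And>u v. u \<in> X \<Longrightarrow> v \<in> X \<Longrightarrow> (u, v) \<in> R \<longleftrightarrow> (f u, f v) \<in> S"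
  shows "equiv Y S"
proof -
  have Y: "f ` X = Y" using bij by (rule bij_betw_imp_surj_on)
  have R: "refl_on X R" "sym R" "trans R" using assms(1) by (auto elim: equivE)
  show ?thesis
  proof (rule equivI)
    show "S \<subseteq> Y \<times> Y" by fact
    show "refl_on Y S"
      unfolding refl_on_def Y[symmetric] using iff refl_onD[OF R(1)] by blast
    show "sym S"
    proof (rule symI)
      fix p q assume pq: "(p, q) \<in> S"
      then obtain u v where "u \<in> X" "v \<in> X" "p = f u" "q = f v" using assms(3) Y by blast
      then show "(q, p) \<in> S" using pq iff symD[OF R(2)] by blast
    qed
    show "trans S"
    proof (rule transI)
      fix p q r assume pq: "(p, q) \<in> S" and qr: "(q, r) \<in> S"
      then obtain u v w where "u \<in> X" "v \<in> X" "w \<in> X" "p = f u" "q = f v" "r = f w"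
        using assms(3) Y by blast
      then show "(p, r) \<in> S" using pq qr iff transD[OF R(3)] by blast
    qed
  qed
qed

text \<open>The bijection of quotients sends a class to its image under \<open>f\<close>.\<close>

lemma bij_betw_quotient_transport:
  assumes "equiv X R" and bij: "bij_betw f X Y" and "S \<subseteq> Y \<times> Y"
    and iff: "\<And>u v. u \<in> X \<Longrightarrow> v \<in> X \<Longrightarrow> (u, v) \<in> R \<longleftrightarrow> (f u, f v) \<in> S"
  shows "bij_betw ((`) f) (X // R) (Y // S)"
proof -
  have Y: "f ` X = Y" using bij by (rule bij_betw_imp_surj_on)
  have RX: "R \<subseteq> X \<times> X" using assms(1) by (auto elim: equivE)
  have cls: "f ` (R `` {u}) = S `` {f u}" if "u \<in> X" for u
  proof
    show "f ` (R `` {u}) \<subseteq> S `` {f u}" using that iff RX by blast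
    show "S `` {f u} \<subseteq> f ` (R `` {u})"
    proof
      fix q assume "q \<in> S `` {f u}"
      then have uq: "(f u, q) \<in> S" by simp
      then obtain v where "v \<in> X" "q = f v" using assms(3) Y by blast
      then show "q \<in> f ` (R `` {u})" using uq iff[OF that] by blast
    qed
  qed
  have "inj_on ((`) f) (Pow X)"
    using bij by (simp add: bij_betw_imp_inj_on inj_on_image_Pow)
  moreover have "X // R \<subseteq> Pow X" using RX by (auto simp: quotient_def)
  ultimately have "inj_on ((`) f) (X // R)" by (rule inj_on_subset)
  moreover have "((`) f) ` (X // R) = Y // S"
  proof -
    have "X // R = (\<lambda>u. R `` {u}) ` X" "Y // S = (\<lambda>v. S `` {v}) ` Y"
      by (auto simp: quotient_def)
    then show ?thesis by (simp add: Y[symmetric] image_image cls)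
  qed
  ultimately show ?thesis by (simp add: bij_betw_def)
qed


section \<open>Coordinates with respect to a one-dimensional complement\<close>

text \<open>A vector space with a subspace \<open>A\<close> and a vector \<open>x\<close> that spans a complement of \<open>A\<close>.\<close>

locale line_complement = vector_space s
  for s :: "'k::field \<Rightarrow> 'e::ab_group_add \<Rightarrow> 'e" +
  fixes A :: "'e set" and x :: 'e
  assumes subspace_A: "subspace A" and x_notin: "x \<notin> A"
    and decomp: "\<exists>a\<in>A. \<exists>k. u = a + s k x"
begin

text \<open>The coordinate of \<open>u\<close> along \<open>x\<close> and the projection of \<open>u\<close> to \<open>A\<close> along \<open>x\<close>.\<close>

definition crd :: "'e \<Rightarrow> 'k" where "crd u = (THE k. u - s k x \<in> A)"
definition prj :: "'e \<Rightarrow> 'e" where "prj u = u - s (crd u) x"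

lemma add_mem: "a \<in> A \<Longrightarrow> b \<in> A \<Longrightarrow> a + b \<in> A"
  and scale_mem: "a \<in> A \<Longrightarrow> s k a \<in> A"
  and diff_mem: "a \<in> A \<Longrightarrow> b \<in> A \<Longrightarrow> a - b \<in> A"
  and zero_mem: "0 \<in> A"
  using subspace_A by (auto intro: subspace_add subspace_scale subspace_diff subspace_0)

lemma crd_eqI:
  assumes "u - s k x \<in> A" shows "crd u = k"
  unfolding crd_def
proof (rule the_equality)
  show "u - s k x \<in> A" by fact
  fix l assume "u - s l x \<in> A"
  then have "(u - s k x) - (u - s l x) \<in> A" using assms by (rule diff_mem[rotated])
  then have *: "s (l - k) x \<in> A" by (simp add: scale_left_diff_distrib)
  show "l = k"
  proof (rule ccontr)
    assume "l \<noteq> k"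
    then have "s (inverse (l - k)) (s (l - k) x) = x" by simp
    then show False using scale_mem[OF *, of "inverse (l - k)"] x_notin by simp
  qed
qed

lemma prj_mem [simp]: "prj u \<in> A"
proof -
  obtain a k where "a \<in> A" "u = a + s k x" using decomp by blast
  then show ?thesis using crd_eqI[of u k] by (simp add: prj_def)
qed

lemma prj_crd: "u = prj u + s (crd u) x"
  by (simp add: prj_def)

lemma crd_A [simp]: "a \<in> A \<Longrightarrow> crd a = 0"
  by (rule crd_eqI) simp

lemma crd_x [simp]: "crd x = 1"
  by (rule crd_eqI) (simp add: zero_mem)

lemma crd_add [simp]: "crd (u + v) = crd u + crd v"
proof (rule crd_eqI)
  have "u + v - s (crd u + crd v) x = prj u + prj v"
    by (simp add: prj_def scale_left_distrib algebra_simps)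
  then show "u + v - s (crd u + crd v) x \<in> A" by (simp add: add_mem)
qed

lemma crd_scale [simp]: "crd (s k u) = k * crd u"
proof (rule crd_eqI)
  have "s k u - s (k * crd u) x = s k (prj u)"
    by (simp add: prj_def scale_right_diff_distrib)
  then show "s k u - s (k * crd u) x \<in> A" by (simp add: scale_mem)
qed

lemma prj_A [simp]: "a \<in> A \<Longrightarrow> prj a = a"
  by (simp add: prj_def)

lemma prj_x [simp]: "prj x = 0"
  by (simp add: prj_def)

lemma prj_add [simp]: "prj (u + v) = prj u + prj v"
  by (simp add: prj_def scale_left_distrib)

lemma prj_scale [simp]: "prj (s k u) = s k (prj u)"
  by (simp add: prj_def scale_right_diff_distrib)

lemma eq_iff_coords: "u = v \<longleftrightarrow> prj u = prj v \<and> crd u = crd v"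
  by (metis prj_crd)

lemma complement_induct [case_names A x add scale]:
  assumes "\<And>a. a \<in> A \<Longrightarrow> P a" and "P x"
    and "\<And>u v. P u \<Longrightarrow> P v \<Longrightarrow> P (u + v)" and "\<And>k u. P u \<Longrightarrow> P (s k u)"
  shows "P u"
  by (subst prj_crd) (intro assms prj_mem)


section \<open>Bilinear products and their structure constants\<close>

text \<open>Bilinear products on the whole space \<open>E\<close>.\<close>

definition bilin :: "('e \<Rightarrow> 'e \<Rightarrow> 'e) \<Rightarrow> bool" where
  "bilin d \<longleftrightarrow>
    (\<forall>u v w. d (u + v) w = d u w + d v w \<and> d u (v + w) = d u v + d u w) \<and>
    (\<forall>k u v. d (s k u) v = s k (d u v) \<and> d u (s k v) = s k (d u v))"

lemma bilinD:
  assumes "bilin d"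
  shows "d (u + v) w = d u w + d v w" "d u (v + w) = d u v + d u w"
    "d (s k u) v = s k (d u v)" "d u (s k v) = s k (d u v)"
  using assms by (auto simp: bilin_def)

text \<open>The two perm identities for one triple of vectors.\<close>

definition perm_at :: "('e \<Rightarrow> 'e \<Rightarrow> 'e) \<Rightarrow> 'e \<Rightarrow> 'e \<Rightarrow> 'e \<Rightarrow> bool" where
  "perm_at d u v w \<longleftrightarrow> d (d u v) w = d u (d v w) \<and> d u (d v w) = d u (d w v)"

lemma perm_algebra_on_UNIV_iff:
  "perm_algebra_on s UNIV d \<longleftrightarrow> bilin d \<and> (\<forall>u v w. perm_at d u v w)"
  by (auto simp: perm_algebra_on_def bilin_def perm_at_def linear_on_def)

lemma perm_at_iff_coords:
  "perm_at d u v w \<longleftrightarrow>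
    prj (d (d u v) w) = prj (d u (d v w)) \<and> crd (d (d u v) w) = crd (d u (d v w)) \<and>
    prj (d u (d v w)) = prj (d u (d w v)) \<and> crd (d u (d v w)) = crd (d u (d w v))"
  unfolding perm_at_def using eq_iff_coords by blast

text \<open>By trilinearity the perm identities need only be tested on \<open>A \<union> {x}\<close>.\<close>

lemma perm_at_all:
  assumes d: "bilin d"
    and gen: "\<And>u v w. u \<in> insert x A \<Longrightarrow> v \<in> insert x A \<Longrightarrow> w \<in> insert x A \<Longrightarrow> perm_at d u v w"
  shows "perm_at d u v w"
proof -
  note lin = perm_at_def bilinD[OF d]
  have 1: "perm_at d u v w" if "u \<in> insert x A" "v \<in> insert x A" for u v w
    by (induction w rule: complement_induct) (use that in \<open>simp_all add: gen\<close>, auto simp: lin)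
  have 2: "perm_at d u v w" if "u \<in> insert x A" for u v w
    by (induction v rule: complement_induct) (use that in \<open>simp_all add: 1\<close>, auto simp: lin)
  show ?thesis
    by (induction u rule: complement_induct) (simp_all add: 2, auto simp: lin)
qed

text \<open>
  The tuple \<open>(h, g, D, T, a0, k0)\<close> with \<open>a x = T a + h a x\<close>, \<open>x a = D a + g a x\<close> and
  \<open>x x = a0 + k0 x\<close>, read off from a product on \<open>E\<close>. The maps are restricted to \<open>A\<close>, so that
  they are extensional as flag data require.
\<close>

definition flag_of :: "('e \<Rightarrow> 'e \<Rightarrow> 'e) \<Rightarrow> ('k, 'e) flag" where
  "flag_of d =
    ((\<lambda>a\<in>A. crd (d a x)), (\<lambda>a\<in>A. crd (d x a)), (\<lambda>a\<in>A. prj (d x a)), (\<lambda>a\<in>A. prj (d a x)),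
     prj (d x x), crd (d x x))"

text \<open>
  The product on \<open>E\<close> that extends \<open>m\<close> bilinearly by the given values of \<open>a x\<close>, \<open>x a\<close>
  and \<open>x x\<close>; the arguments are expanded as \<open>u = prj u + crd u x\<close>.
\<close>

definition flag_prod :: "('e \<Rightarrow> 'e \<Rightarrow> 'e) \<Rightarrow> ('k, 'e) flag \<Rightarrow> 'e \<Rightarrow> 'e \<Rightarrow> 'e" where
  "flag_prod m = (\<lambda>(h, g, D, T, a0, k0) u v.
    m (prj u) (prj v)
    + s (crd v) (T (prj u) + s (h (prj u)) x)
    + s (crd u) (D (prj v) + s (g (prj v)) x)
    + s (crd u * crd v) (a0 + s k0 x))"

end

text \<open>The subspace \<open>A\<close> is moreover a perm algebra with product \<open>m\<close>.\<close>

locale perm_line_complement = line_complement s A x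
  for s :: "'k::field \<Rightarrow> 'e::ab_group_add \<Rightarrow> 'e" and A :: "'e set" and x :: 'e +
  fixes m :: "'e \<Rightarrow> 'e \<Rightarrow> 'e"
  assumes perm_A: "perm_algebra_on s A m"
begin

lemma m_mem [simp]: "a \<in> A \<Longrightarrow> b \<in> A \<Longrightarrow> m a b \<in> A"
  using perm_A by (simp add: perm_algebra_on_def)

lemma m_add:
  "a \<in> A \<Longrightarrow> b \<in> A \<Longrightarrow> c \<in> A \<Longrightarrow> m (a + b) c = m a c + m b c"
  "a \<in> A \<Longrightarrow> b \<in> A \<Longrightarrow> c \<in> A \<Longrightarrow> m a (b + c) = m a b + m a c"
  using perm_A by (auto simp: perm_algebra_on_def linear_on_def)

lemma m_scale:
  "a \<in> A \<Longrightarrow> b \<in> A \<Longrightarrow> m (s k a) b = s k (m a b)"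
  "a \<in> A \<Longrightarrow> b \<in> A \<Longrightarrow> m a (s k b) = s k (m a b)"
  using perm_A by (auto simp: perm_algebra_on_def linear_on_def)

lemma m_perm:
  assumes "a \<in> A" "b \<in> A" "c \<in> A"
  shows "m (m a b) c = m a (m b c)" "m a (m b c) = m a (m c b)"
  using perm_A assms unfolding perm_algebra_on_def by blast+

lemma m_zero: "a \<in> A \<Longrightarrow> m a 0 = 0" "a \<in> A \<Longrightarrow> m 0 a = 0"
  using m_scale(2)[of a 0 0] m_scale(1)[of 0 a 0] by (simp_all add: zero_mem)

text \<open>
  For a bilinear product extending \<open>m\<close>, the perm identities on \<open>A \<union> {x}\<close> are, component by
  component, the equations of a flag datum.
\<close>

lemma flag_datum_flag_of_iff:
  assumes d: "bilin d" and ext: "\<And>a b. a \<in> A \<Longrightarrow> b \<in> A \<Longrightarrow> d a b = m a b"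
  shows "flag_datum s A m (flag_of d) \<longleftrightarrow> (\<forall>u v w. perm_at d u v w)"
proof -
  define h g D T where "h = (\<lambda>a. crd (d a x))" and "g = (\<lambda>a. crd (d x a))"
    and "D = (\<lambda>a. prj (d x a))" and "T = (\<lambda>a. prj (d a x))"
  define a0 k0 where "a0 = prj (d x x)" and "k0 = crd (d x x)"
  note lin = bilinD[OF d]
  have ax: "d a x = T a + s (h a) x" and xa: "d x a = D a + s (g a) x" if "a \<in> A" for a
    by (simp_all add: T_def h_def D_def g_def flip: prj_crd)
  have xx: "d x x = a0 + s k0 x"
    by (simp add: a0_def k0_def flip: prj_crd)
  have mem [simp]: "T a \<in> A" "D a \<in> A" "a0 \<in> A" for a
    by (simp_all add: T_def D_def a0_def)
  note prod = perm_at_iff_coords ext ax xa xx lin scale_mem add_mem add.commute add.left_commute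
    mult.commute x_notin
  have AAA: "perm_at d a b c" if "a \<in> A" "b \<in> A" "c \<in> A" for a b c
    using that m_perm[OF that] by (simp add: perm_at_def ext)
  have AAX: "perm_at d a b x \<longleftrightarrow>
      T (m a b) = m a (T b) + s (h b) (T a) \<and> h (m a b) = h a * h b \<and>
      m a (T b) + s (h b) (T a) = m a (D b) + s (g b) (T a) \<and> h a * h b = h a * g b"
    and AXA: "perm_at d a x b \<longleftrightarrow>
      m (T a) b + s (h a) (D b) = m a (D b) + s (g b) (T a) \<and>
      m a (T b) + s (h b) (T a) = m a (D b) + s (g b) (T a) \<and> h a * h b = h a * g b"
    and XAA: "perm_at d x a b \<longleftrightarrow>
      m (D a) b + s (g a) (D b) = D (m a b) \<and> g a * g b = g (m a b) \<and>
      D (m a b) = D (m b a) \<and> g (m a b) = g (m b a)"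
    if "a \<in> A" "b \<in> A" for a b
    using that by (auto simp: prod)
  have AXX: "perm_at d a x x \<longleftrightarrow>
      T (T a) + s (h a) a0 = m a a0 + s k0 (T a) \<and> h (T a) = 0"
    and XAX: "perm_at d x a x \<longleftrightarrow>
      T (D a) + s (g a) a0 = D (T a) + s (h a) a0 \<and> k0 * g a + h (D a) = k0 * h a + g (T a) \<and>
      D (T a) + s (h a) a0 = D (D a) + s (g a) a0 \<and> k0 * h a + g (T a) = k0 * g a + g (D a)"
    and XXA: "perm_at d x x a \<longleftrightarrow>
      m a0 a + s k0 (D a) = D (D a) + s (g a) a0 \<and> k0 * g a = k0 * g a + g (D a) \<and>
      D (T a) + s (h a) a0 = D (D a) + s (g a) a0 \<and> k0 * h a + g (T a) = k0 * g a + g (D a)"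
    if "a \<in> A" for a
    using that by (auto simp: prod)
  have XXX: "perm_at d x x x \<longleftrightarrow> T a0 = D a0 \<and> g a0 = h a0"
    by (auto simp: prod)
  have "(\<forall>u v w. perm_at d u v w) \<longleftrightarrow>
      (\<forall>a\<in>A. \<forall>b\<in>A. perm_at d a b x \<and> perm_at d a x b \<and> perm_at d x a b) \<and>
      (\<forall>a\<in>A. perm_at d a x x \<and> perm_at d x a x \<and> perm_at d x x a) \<and> perm_at d x x x"
    (is "?L \<longleftrightarrow> ?R")
  proof
    assume R: ?R
    show ?L
    proof (intro allI)
      fix u v w
      show "perm_at d u v w" by (rule perm_at_all[OF d]) (use R AAA in auto)
    qed
  qed simp
  also have "\<dots> \<longleftrightarrow> flag_datum s A m
      (restrict h A, restrict g A, restrict D A, restrict T A, a0, k0)"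
  proof -
    have "linear_on A s (*) (restrict h A)" "linear_on A s (*) (restrict g A)"
      "linear_on A s s (restrict D A)" "linear_on A s s (restrict T A)"
      by (auto simp: linear_on_def h_def g_def D_def T_def lin add_mem scale_mem)
    moreover have "perm_at d a b x \<and> perm_at d a x b \<and> perm_at d x a b \<longleftrightarrow>
        h (m a b) = h a * h b \<and> h a * h b = h a * g b \<and>
        g (m a b) = g (m b a) \<and> g (m b a) = g a * g b \<and>
        D (m a b) = D (m b a) \<and> D (m b a) = m (D a) b + s (g a) (D b) \<and>
        T (m a b) = m a (T b) + s (h b) (T a) \<and>
        m a (T b) + s (h b) (T a) = m a (D b) + s (g b) (T a) \<and>
        m a (D b) + s (g b) (T a) = m (T a) b + s (h a) (D b)"
      if "a \<in> A" "b \<in> A" for a b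
      unfolding AAX[OF that] AXA[OF that] XAA[OF that] by metis
    moreover have "perm_at d a x x \<and> perm_at d x a x \<and> perm_at d x x a \<longleftrightarrow>
        h (T a) = 0 \<and>
        k0 * g a = k0 * g a + g (D a) \<and>
        k0 * g a + g (D a) = k0 * h a + g (T a) \<and>
        k0 * h a + g (T a) = k0 * g a + h (D a) \<and>
        m a a0 + s k0 (T a) = T (T a) + s (h a) a0 \<and>
        m a0 a + s k0 (D a) = D (D a) + s (g a) a0 \<and>
        D (D a) + s (g a) a0 = D (T a) + s (h a) a0 \<and>
        D (T a) + s (h a) a0 = T (D a) + s (g a) a0"
      if "a \<in> A" for a
      unfolding AXX[OF that] XAX[OF that] XXA[OF that] by metis
    ultimately show ?thesis
      unfolding flag_datum_def XXX by (simp cong: ball_cong) blast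
  qed
  finally show ?thesis
    by (simp add: flag_of_def h_def g_def D_def T_def a0_def k0_def)
qed

lemma ext_structures_iff:
  "d \<in> ext_structures s A m \<longleftrightarrow>
    bilin d \<and> (\<forall>a\<in>A. \<forall>b\<in>A. d a b = m a b) \<and> (\<forall>u v w. perm_at d u v w)"
  by (auto simp: ext_structures_def perm_algebra_on_UNIV_iff)

lemma flag_of_flag_prod:
  assumes "flag_datum s A m F"
  shows "flag_of (flag_prod m F) = F"
proof -
  obtain h g D T a0 k0 where F: "F = (h, g, D, T, a0, k0)" by (cases F)
  have lin: "linear_on A s (*) h" "linear_on A s (*) g" "linear_on A s s D" "linear_on A s s T"
    and ext: "h \<in> extensional A" "g \<in> extensional A" "D \<in> extensional A" "T \<in> extensional A"
    and mem: "a0 \<in> A" "\<And>a. a \<in> A \<Longrightarrow> D a \<in> A" "\<And>a. a \<in> A \<Longrightarrow> T a \<in> A"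
    using assms by (auto simp: F flag_datum_def PiE_def)
  have z: "D 0 = 0" "T 0 = 0" "h 0 = 0" "g 0 = 0"
    using lin zero_mem unfolding linear_on_def by (metis scale_zero_left mult_zero_left)+
  have e: "flag_prod m F a x = T a + s (h a) x" "flag_prod m F x a = D a + s (g a) x"
    if "a \<in> A" for a
    using that by (simp_all add: F flag_prod_def z m_zero zero_mem)
  have xx: "flag_prod m F x x = a0 + s k0 x"
    by (simp add: F flag_prod_def z m_zero zero_mem)
  have "(\<lambda>a\<in>A. crd (flag_prod m F a x)) = h" "(\<lambda>a\<in>A. crd (flag_prod m F x a)) = g"
    "(\<lambda>a\<in>A. prj (flag_prod m F x a)) = D" "(\<lambda>a\<in>A. prj (flag_prod m F a x)) = T"
    using ext mem by (auto intro!: extensionalityI[of _ A] simp: e)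
  then show ?thesis
    using mem(1) by (simp add: flag_of_def xx) (simp add: F)
qed

lemma flag_prod_mem:
  assumes "flag_datum s A m F"
  shows "flag_prod m F \<in> ext_structures s A m"
proof -
  obtain h g D T a0 k0 where F: "F = (h, g, D, T, a0, k0)" by (cases F)
  have lin: "linear_on A s (*) h" "linear_on A s (*) g" "linear_on A s s D" "linear_on A s s T"
    using assms by (auto simp: F flag_datum_def)
  then have bilin: "bilin (flag_prod m F)"
    unfolding bilin_def linear_on_def
    by (simp add: F flag_prod_def m_add m_scale algebra_simps)
  moreover have ext: "flag_prod m F a b = m a b" if "a \<in> A" "b \<in> A" for a b
    using that by (simp add: F flag_prod_def)
  ultimately show ?thesis
    using flag_datum_flag_of_iff[OF bilin ext] assms
    by (simp add: ext_structures_iff flag_of_flag_prod)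
qed

lemma flag_prod_flag_of:
  assumes d: "bilin d" and "\<And>a b. a \<in> A \<Longrightarrow> b \<in> A \<Longrightarrow> d a b = m a b"
  shows "flag_prod m (flag_of d) = d"
proof (intro ext)
  fix u v
  have "d u v = d (prj u + s (crd u) x) (prj v + s (crd v) x)"
    by (simp flip: prj_crd)
  also have "\<dots> = d (prj u) (prj v) + s (crd v) (d (prj u) x) + s (crd u) (d x (prj v))
      + s (crd u * crd v) (d x x)"
    by (simp add: bilinD[OF d] algebra_simps)
  also have "\<dots> = flag_prod m (flag_of d) u v"
    by (simp add: flag_prod_def flag_of_def assms(2) flip: prj_crd)
  finally show "flag_prod m (flag_of d) u v = d u v" ..
qed

lemma bij_betw_flag_of: "bij_betw flag_of (ext_structures s A m) (FL s A m)"
proof (rule bij_betw_byWitness[where f' = "flag_prod m"])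
  show "\<forall>d\<in>ext_structures s A m. flag_prod m (flag_of d) = d"
    by (auto simp: ext_structures_iff intro: flag_prod_flag_of)
  show "\<forall>F\<in>FL s A m. flag_of (flag_prod m F) = F"
    by (simp add: FL_def flag_of_flag_prod)
  show "flag_of ` ext_structures s A m \<subseteq> FL s A m"
    by (auto simp: ext_structures_iff FL_def flag_datum_flag_of_iff)
  show "flag_prod m ` FL s A m \<subseteq> ext_structures s A m"
    by (auto simp: FL_def flag_prod_mem)
qed


section \<open>Isomorphisms that fix the subalgebra\<close>

text \<open>The linear endomorphism of \<open>E\<close> that is the identity on \<open>A\<close> and sends \<open>x\<close> to \<open>b + l x\<close>.\<close>

definition shear :: "'e \<Rightarrow> 'k \<Rightarrow> 'e \<Rightarrow> 'e" where
  "shear b l u = prj u + s (crd u) (b + s l x)"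

lemma shear_A [simp]: "a \<in> A \<Longrightarrow> shear b l a = a"
  and shear_x [simp]: "shear b l x = b + s l x"
  and shear_add: "shear b l (u + v) = shear b l u + shear b l v"
  and shear_scale: "shear b l (s k u) = s k (shear b l u)"
  by (simp_all add: shear_def algebra_simps)

lemma linear_endo_iff:
  "Vector_Spaces.linear s s \<phi> \<longleftrightarrow>
    (\<forall>u v. \<phi> (u + v) = \<phi> u + \<phi> v) \<and> (\<forall>k u. \<phi> (s k u) = s k (\<phi> u))"
  using vector_space_axioms
  by (auto simp: Vector_Spaces.linear_def module_hom_def module_hom_axioms_def
      module_iff_vector_space)

lemma linear_shear: "Vector_Spaces.linear s s (shear b l)"
  by (simp add: linear_endo_iff vector_space_axioms shear_add shear_scale)

lemma linear_fixing_eq_shear: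
  assumes "Vector_Spaces.linear s s \<phi>" and "\<forall>a\<in>A. \<phi> a = a"
  shows "\<phi> = shear (prj (\<phi> x)) (crd (\<phi> x))"
proof
  fix u
  show "\<phi> u = shear (prj (\<phi> x)) (crd (\<phi> x)) u"
    by (induction u rule: complement_induct)
      (use assms in \<open>simp_all add: shear_add shear_scale linear_endo_iff flip: prj_crd\<close>)
qed

lemma shear_0_1: "shear 0 1 u = u"
  by (simp add: shear_def flip: prj_crd)

lemma shear_shear:
  assumes "b' \<in> A"
  shows "shear b l (shear b' l' u) = shear (b' + s l' b) (l' * l) u"
  using assms
  by (simp add: shear_def[of b' l'] shear_add shear_scale)
    (simp add: shear_def add.assoc scale_right_distrib)

lemma bij_shear_iff:
  assumes "b \<in> A"
  shows "bij (shear b l) \<longleftrightarrow> l \<noteq> 0"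
proof
  assume "bij (shear b l)"
  show "l \<noteq> 0"
  proof
    assume "l = 0"
    then have "shear b l x = shear b l b" using assms by simp
    then have "x = b" by (rule injD[OF bij_is_inj[OF \<open>bij (shear b l)\<close>]])
    then show False using assms x_notin by simp
  qed
next
  assume l: "l \<noteq> 0"
  let ?b = "s (- inverse l) b"
  have "?b \<in> A" using assms by (rule scale_mem)
  then have "shear b l \<circ> shear ?b (inverse l) = id" "shear ?b (inverse l) \<circ> shear b l = id"
    using assms l by (simp_all add: fun_eq_iff shear_shear shear_0_1)
  then show "bij (shear b l)" by (intro o_bij)
qed

text \<open>Multiplicativity of a shear, tested on \<open>A \<union> {x}\<close>.\<close>

lemma shear_hom_iff:
  assumes d: "bilin d" and d': "bilin d'"
    and ext: "\<And>a c. a \<in> A \<Longrightarrow> c \<in> A \<Longrightarrow> d a c = m a c"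
    and ext': "\<And>a c. a \<in> A \<Longrightarrow> c \<in> A \<Longrightarrow> d' a c = m a c"
  shows "(\<forall>u v. shear b l (d u v) = d' (shear b l u) (shear b l v)) \<longleftrightarrow>
    (\<forall>a\<in>A. shear b l (d a x) = d' a (b + s l x) \<and> shear b l (d x a) = d' (b + s l x) a) \<and>
    shear b l (d x x) = d' (b + s l x) (b + s l x)"
    (is "?L \<longleftrightarrow> ?R")
proof
  assume L: ?L
  have "shear b l (d u v) = d' (shear b l u) (shear b l v)" for u v using L by blast
  from this[of _ x] this[of x] show ?R by simp
next
  assume R: ?R
  note lin = bilinD[OF d] bilinD[OF d'] shear_add shear_scale
  have 1: "shear b l (d u v) = d' (shear b l u) (shear b l v)" if "u \<in> insert x A" for u v
    by (induction v rule: complement_induct)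
      (use that R in \<open>auto simp: ext ext'\<close>, simp_all only: lin)
  have "shear b l (d u v) = d' (shear b l u) (shear b l v)" for u v
    by (induction u rule: complement_induct) (simp_all add: 1, simp_all only: lin)
  then show ?L by blast
qed

text \<open>
  A linear map that fixes \<open>A\<close> is a shear, and a shear is bijective if and only if \<open>l \<noteq> 0\<close>.
\<close>

lemma ext_equiv_iff_shear:
  "(d, d') \<in> ext_equiv s A m \<longleftrightarrow> d \<in> ext_structures s A m \<and> d' \<in> ext_structures s A m \<and>
    (\<exists>b\<in>A. \<exists>l. l \<noteq> 0 \<and> (\<forall>u v. shear b l (d u v) = d' (shear b l u) (shear b l v)))"
proof -
  have "(\<exists>\<phi>. perm_iso s d d' \<phi> \<and> (\<forall>a\<in>A. \<phi> a = a)) \<longleftrightarrow>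
    (\<exists>b\<in>A. \<exists>l. l \<noteq> 0 \<and> (\<forall>u v. shear b l (d u v) = d' (shear b l u) (shear b l v)))"
    (is "?L \<longleftrightarrow> ?R")
  proof
    assume ?L
    then obtain \<phi> where \<phi>: "perm_iso s d d' \<phi>" "\<forall>a\<in>A. \<phi> a = a" by blast
    then obtain b l where "b \<in> A" "\<phi> = shear b l"
      using linear_fixing_eq_shear[of \<phi>] prj_mem unfolding perm_iso_def by blast
    then show ?R using \<phi>(1) bij_shear_iff[of b l] unfolding perm_iso_def by blast
  next
    assume ?R
    then show ?L
      unfolding perm_iso_def using linear_shear bij_shear_iff shear_A by blast
  qed
  then show ?thesis by (simp add: ext_equiv_def)
qed

lemma flag_equiv_iff:
  "((h, g, D, T, a0, k0), (h', g', D', T', a0', k0')) \<in> flag_equiv s A m \<longleftrightarrow>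
    (h, g, D, T, a0, k0) \<in> FL s A m \<and> (h', g', D', T', a0', k0') \<in> FL s A m \<and>
    h = h' \<and> g = g' \<and>
    (\<exists>b\<in>A. \<exists>l. l \<noteq> 0 \<and>
      (\<forall>a\<in>A. D a = m b a + s l (D' a) - s (g a) b \<and>
             T a = m a b + s l (T' a) - s (h a) b) \<and>
      a0 = m b b + s l (D' b) + s l (T' b) + s (l\<^sup>2) a0' - s k0 b \<and>
      k0 = l * k0' + h' b + g' b)"
  unfolding flag_equiv_def by blast

text \<open>
  The maps in \<open>flag_of d\<close> are the components \<open>h\<close>, \<open>g\<close>, \<open>D\<close>, \<open>T\<close> of the proof, restricted
  to \<open>A\<close>; the primed ones belong to \<open>d'\<close>. Comparing components in \<open>shear_hom_iff\<close> gives
  \<open>h = h'\<close> from \<open>a x\<close> and \<open>g = g'\<close> from \<open>x a\<close>, after cancelling \<open>l\<close>, together with the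
  formulas for \<open>T\<close>, \<open>D\<close>, \<open>a0\<close> and \<open>k0\<close>.
\<close>

lemma ext_equiv_iff_flag_equiv:
  assumes "d \<in> ext_structures s A m" and "d' \<in> ext_structures s A m"
  shows "(d, d') \<in> ext_equiv s A m \<longleftrightarrow> (flag_of d, flag_of d') \<in> flag_equiv s A m"
proof -
  have d: "bilin d" "\<And>a c. a \<in> A \<Longrightarrow> c \<in> A \<Longrightarrow> d a c = m a c"
    and d': "bilin d'" "\<And>a c. a \<in> A \<Longrightarrow> c \<in> A \<Longrightarrow> d' a c = m a c"
    using assms by (simp_all add: ext_structures_iff)
  define h g D T where "h = (\<lambda>a. crd (d a x))" and "g = (\<lambda>a. crd (d x a))"
    and "D = (\<lambda>a. prj (d x a))" and "T = (\<lambda>a. prj (d a x))"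
  define a0 k0 where "a0 = prj (d x x)" and "k0 = crd (d x x)"
  define h' g' D' T' where "h' = (\<lambda>a. crd (d' a x))" and "g' = (\<lambda>a. crd (d' x a))"
    and "D' = (\<lambda>a. prj (d' x a))" and "T' = (\<lambda>a. prj (d' a x))"
  define a0' k0' where "a0' = prj (d' x x)" and "k0' = crd (d' x x)"
  have e: "d a x = T a + s (h a) x" "d x a = D a + s (g a) x"
    "d' a x = T' a + s (h' a) x" "d' x a = D' a + s (g' a) x" if "a \<in> A" for a
    by (simp_all add: T_def h_def D_def g_def T'_def h'_def D'_def g'_def flip: prj_crd)
  have xx: "d x x = a0 + s k0 x" "d' x x = a0' + s k0' x"
    by (simp_all add: a0_def k0_def a0'_def k0'_def flip: prj_crd)
  have mem [simp]: "T a \<in> A" "D a \<in> A" "a0 \<in> A" "T' a \<in> A" "D' a \<in> A" "a0' \<in> A" for a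
    by (simp_all add: T_def D_def a0_def T'_def D'_def a0'_def)
  have flag: "flag_of d = (restrict h A, restrict g A, restrict D A, restrict T A, a0, k0)"
    "flag_of d' = (restrict h' A, restrict g' A, restrict D' A, restrict T' A, a0', k0')"
    by (simp_all add: flag_of_def h_def g_def D_def T_def a0_def k0_def
        h'_def g'_def D'_def T'_def a0'_def k0'_def)
  have FL: "flag_of d \<in> FL s A m" "flag_of d' \<in> FL s A m"
    using bij_betw_flag_of assms by (auto dest: bij_betw_apply)
  have coords: "shear b l u = v \<longleftrightarrow>
      prj (shear b l u) = prj v \<and> crd (shear b l u) = crd v" for b l u v
    by (rule eq_iff_coords)
  note prod = d(2) d'(2) e xx bilinD[OF d'(1)] shear_add shear_scale scale_mem add_mem
  have ax: "shear b l (d a x) = d' a (b + s l x) \<longleftrightarrow>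
      T a = m a b + s l (T' a) - s (h a) b \<and> h a = h' a"
    and xa: "shear b l (d x a) = d' (b + s l x) a \<longleftrightarrow>
      D a = m b a + s l (D' a) - s (g a) b \<and> g a = g' a"
    if "a \<in> A" "b \<in> A" "l \<noteq> 0" for a b l
    unfolding coords using that by (auto simp: prod eq_diff_eq)
  \<comment> \<open>The coordinate along \<open>x\<close> yields the equation for \<open>k0\<close> multiplied by \<open>l\<close>.\<close>
  have XX: "shear b l (d x x) = d' (b + s l x) (b + s l x) \<longleftrightarrow>
      a0 = m b b + s l (D' b) + s l (T' b) + s (l\<^sup>2) a0' - s k0 b \<and>
      k0 = l * k0' + h' b + g' b"
    if "b \<in> A" "l \<noteq> 0" for b l
  proof -
    have "shear b l (d x x) = d' (b + s l x) (b + s l x) \<longleftrightarrow>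
      a0 + s k0 b = m b b + s l (D' b) + s l (T' b) + s (l\<^sup>2) a0' \<and>
      l * k0 = l * (l * k0' + h' b + g' b)"
      unfolding coords using that by (simp add: prod power2_eq_square algebra_simps)
    then show ?thesis using that by (simp add: eq_diff_eq)
  qed
  have ext: "restrict p A = restrict q A \<longleftrightarrow> (\<forall>a\<in>A. p a = q a)" for p q :: "'e \<Rightarrow> 'k"
    by (metis restrict_apply' restrict_ext)
  have "(flag_of d, flag_of d') \<in> flag_equiv s A m \<longleftrightarrow>
      (\<forall>a\<in>A. h a = h' a) \<and> (\<forall>a\<in>A. g a = g' a) \<and>
      (\<exists>b\<in>A. \<exists>l. l \<noteq> 0 \<and>
        (\<forall>a\<in>A. D a = m b a + s l (D' a) - s (g a) b \<and>
               T a = m a b + s l (T' a) - s (h a) b) \<and>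
        a0 = m b b + s l (D' b) + s l (T' b) + s (l\<^sup>2) a0' - s k0 b \<and>
        k0 = l * k0' + h' b + g' b)"
    using FL unfolding flag flag_equiv_iff by (simp add: ext cong: bex_cong)
  also have "\<dots> \<longleftrightarrow> (\<exists>b\<in>A. \<exists>l. l \<noteq> 0 \<and>
      (\<forall>a\<in>A. shear b l (d a x) = d' a (b + s l x) \<and> shear b l (d x a) = d' (b + s l x) a) \<and>
      shear b l (d x x) = d' (b + s l x) (b + s l x))"
    (is "?L \<longleftrightarrow> ?R")
  proof
    assume ?L
    then obtain b l where "b \<in> A" "l \<noteq> 0" "\<forall>a\<in>A. h a = h' a" "\<forall>a\<in>A. g a = g' a"
      "\<forall>a\<in>A. D a = m b a + s l (D' a) - s (g a) b \<and> T a = m a b + s l (T' a) - s (h a) b"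
      "a0 = m b b + s l (D' b) + s l (T' b) + s (l\<^sup>2) a0' - s k0 b \<and>
       k0 = l * k0' + h' b + g' b" by blast
    then show ?R
      using ax xa XX by (intro bexI[of _ b] exI[of _ l]) auto
  next
    assume ?R
    then obtain b l where bl: "b \<in> A" "l \<noteq> 0"
      and *: "\<And>a. a \<in> A \<Longrightarrow> shear b l (d a x) = d' a (b + s l x)"
        "\<And>a. a \<in> A \<Longrightarrow> shear b l (d x a) = d' (b + s l x) a"
        "shear b l (d x x) = d' (b + s l x) (b + s l x)" by blast
    have "\<forall>a\<in>A. h a = h' a" "\<forall>a\<in>A. g a = g' a"
      "\<forall>a\<in>A. D a = m b a + s l (D' a) - s (g a) b \<and> T a = m a b + s l (T' a) - s (h a) b"
      "a0 = m b b + s l (D' b) + s l (T' b) + s (l\<^sup>2) a0' - s k0 b \<and>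
       k0 = l * k0' + h' b + g' b"
      using ax[OF _ bl] xa[OF _ bl] XX[OF bl] * by blast+
    then show ?L using bl by blast
  qed
  also have "\<dots> \<longleftrightarrow> (d, d') \<in> ext_equiv s A m"
    using assms by (simp add: ext_equiv_iff_shear shear_hom_iff[OF d(1) d'(1) d(2) d'(2)])
  finally show ?thesis ..
qed

lemma equiv_ext_equiv: "equiv (ext_structures s A m) (ext_equiv s A m)"
proof (rule equivI)
  show "ext_equiv s A m \<subseteq> ext_structures s A m \<times> ext_structures s A m"
    by (auto simp: ext_equiv_def)
  show "refl_on (ext_structures s A m) (ext_equiv s A m)"
  proof (rule refl_onI)
    fix d assume "d \<in> ext_structures s A m"
    moreover have "perm_iso s d d id"
      by (simp add: perm_iso_def linear_endo_iff vector_space_axioms)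
    ultimately show "(d, d) \<in> ext_equiv s A m"
      unfolding ext_equiv_def by (auto intro!: exI[of _ id])
  qed
  show "sym (ext_equiv s A m)"
  proof (rule symI)
    fix d d' assume "(d, d') \<in> ext_equiv s A m"
    then obtain \<phi> where \<phi>: "d \<in> ext_structures s A m" "d' \<in> ext_structures s A m"
      "perm_iso s d d' \<phi>" "\<forall>a\<in>A. \<phi> a = a" by (auto simp: ext_equiv_def)
    then have bij: "bij \<phi>" by (simp add: perm_iso_def)
    have inv: "\<phi> (inv \<phi> u) = u" "inv \<phi> (\<phi> u) = u" for u
      using bij by (simp_all add: bij_is_surj surj_f_inv_f bij_is_inj)
    have eqI: "inv \<phi> u = v" if "u = \<phi> v" for u v using that inv by simp
    have "perm_iso s d' d (inv \<phi>)"
      using \<phi>(3) bij bij_imp_bij_inv[OF bij]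
      by (auto simp: perm_iso_def linear_endo_iff inv intro!: eqI)
    moreover have "\<forall>a\<in>A. inv \<phi> a = a" using \<phi>(4) by (auto intro: eqI)
    ultimately show "(d', d) \<in> ext_equiv s A m" using \<phi> by (auto simp: ext_equiv_def)
  qed
  show "trans (ext_equiv s A m)"
  proof (rule transI)
    fix d1 d2 d3 assume "(d1, d2) \<in> ext_equiv s A m" "(d2, d3) \<in> ext_equiv s A m"
    then obtain \<phi> \<psi> where "d1 \<in> ext_structures s A m" "d3 \<in> ext_structures s A m"
      "perm_iso s d1 d2 \<phi>" "\<forall>a\<in>A. \<phi> a = a" "perm_iso s d2 d3 \<psi>" "\<forall>a\<in>A. \<psi> a = a"
      by (auto simp: ext_equiv_def)
    moreover from this have "perm_iso s d1 d3 (\<psi> \<circ> \<phi>)"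
      by (auto simp: perm_iso_def linear_endo_iff intro: bij_comp)
    ultimately show "(d1, d3) \<in> ext_equiv s A m"
      unfolding ext_equiv_def by (auto intro!: exI[of _ "\<psi> \<circ> \<phi>"])
  qed
qed

end


section \<open>The classification\<close>

theorem theorem2p25:
  fixes s :: "'k::field_char_0 \<Rightarrow> 'e::ab_group_add \<Rightarrow> 'e"
    and A V :: "'e set" and m :: "'e \<Rightarrow> 'e \<Rightarrow> 'e" and x :: 'e
  assumes "vector_space s"
    and "perm_algebra_on s A m"
    and "V = module.span s {x}" and "x \<noteq> 0"
    and "A \<inter> V = {0}" and "{a + v | a v. a \<in> A \<and> v \<in> V} = UNIV"
  shows "equiv (FL s A m) (flag_equiv s A m) \<and>
    (\<exists>f. bij_betw f (Ext s A m) (FL s A m // flag_equiv s A m))"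
proof -
  interpret vector_space s by fact
  have V: "V = range (\<lambda>k. s k x)" unfolding assms(3) by (rule span_singleton)
  interpret perm_line_complement s A x m
  proof
    show "subspace A" using assms(2) by (simp add: perm_algebra_on_def)
    have "x \<in> V" unfolding assms(3) by (simp add: span_base)
    then show "x \<notin> A" using assms(4,5) by blast
    show "\<exists>a\<in>A. \<exists>k. u = a + s k x" for u
    proof -
      have "u \<in> {a + v | a v. a \<in> A \<and> v \<in> V}" unfolding assms(6) ..
      then show ?thesis unfolding V by blast
    qed
    show "perm_algebra_on s A m" by fact
  qed
  have "flag_equiv s A m \<subseteq> FL s A m \<times> FL s A m" by (auto simp: flag_equiv_def)
  note transport = equiv_ext_equiv bij_betw_flag_of this ext_equiv_iff_flag_equiv
  show ?thesis
    using equiv_transport[OF transport] bij_betw_quotient_transport[OF transport]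
    unfolding Ext_def by blast
qed

end
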